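(* Let $n$ be a positive integer and let $P=P(p_1,p_2,\dots,p_n)$ be a pretzel knot of even type, where $p_1$ is an even integer and $p_i$ is an odd integer (of arbitrary sign) for $2\le i\le n$. Let $a_2(P)$ be the second coefficient of its Conway polynomial. Then: (1) If $n$ is even, then $$a_2(P)=\frac18\sum_{i=1}^{n}p_i^2+\frac14p_1\sum_{i=2}^{n}p_i-\frac18(n-1).$$ (2) If $n$ is odd, then $$a_2(P)=\frac18\sum_{i=2}^{n}p_i^2-\frac14p_1\sum_{i=2}^{n}p_i-\frac18(n-1).$$
   Context: The Conway polynomial $\nabla_L(z)$ of an oriented link is defined by $\nabla_O=1$ for the trivial knot $O$ and $\nabla_{L_+}-\nabla_{L_-}=z\nabla_{L_0}$; for a knot $K$, the second coefficient $a_2(K)$ is the coefficient of $z^2$. The pretzel link $P(p_1,\dots,p_n)$ is obtained from $n$ vertical two-strand twisted columns (twisted bands) placed side by side, the $i$-th having $|p_i|$ half-twists (crossings) with handedness given by the sign of $p_i$, by joining adjacent columns cyclically at the top and at the bottom in the standard way. It is a knot iff exactly one $p_i$ is even, or all $p_i$ are odd and $n$ is odd; when exactly one $p_i$ is even (taken to be $p_1$) it is called of even type. Knots are not distinguished from their mirror images ($a_2$ is invariant under mirror image). *)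

theory Defs
  imports Complex_Main "HOL-Computational_Algebra.Polynomial"
begin

text \<open>
  Oriented links are presented by planar diagrams in general position with respect to the height
  function, and read from top to bottom: every level between two events is a row of vertical
  strands, and every event is a local maximum (\<open>Cap\<close>), a local minimum (\<open>Cup\<close>) or a crossing.
  An event \<open>(i, e)\<close> has exactly \<open>i\<close> strands to its left. Two diagrams present isotopic links iff
  they are related by the Reidemeister moves together with the planar isotopies that change the
  height function (Freyd-Yetter, Turaev).

  \<open>Crossing True\<close>: the strand running from upper left to lower right passes over.
  \<open>Crossing False\<close>: the strand running from upper right to lower left passes over.
  The parameter of a \<open>Cap\<close> is the orientation of its left leg, \<open>True\<close> meaning downwards; in an
  unoriented diagram it has type \<open>unit\<close>.
\<close>

datatype 'o piece = Cap 'o | Cup | Crossing bool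

type_synonym 'o diagram = "(nat \<times> 'o piece) list"

text \<open>A level of an oriented diagram lists the directions of its strands (\<open>True\<close>: downwards).\<close>

inductive elementary :: "bool piece \<Rightarrow> bool list \<Rightarrow> bool list \<Rightarrow> bool" where
  "elementary (Cap b) [] [b, \<not> b]"
| "elementary Cup [b, \<not> b] []"
| "elementary (Crossing s) [b, c] [c, b]"

inductive tangle :: "bool list \<Rightarrow> bool diagram \<Rightarrow> bool list \<Rightarrow> bool" where
  "tangle l [] l"
| "elementary e l l' \<Longrightarrow> tangle (xs @ l' @ ys) D m \<Longrightarrow>
     tangle (xs @ l @ ys) ((length xs, e) # D) m"

definition link_diagram :: "bool diagram \<Rightarrow> bool" where
  "link_diagram D \<longleftrightarrow> tangle [] D []"

definition is_orientation_of :: "bool diagram \<Rightarrow> unit diagram \<Rightarrow> bool" where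
  "is_orientation_of D U \<longleftrightarrow>
     link_diagram D \<and> map (map_prod id (map_piece (\<lambda>_. ()))) D = U"


fun strands_above :: "'o piece \<Rightarrow> nat" where
  "strands_above (Cap _) = 0"
| "strands_above Cup = 2"
| "strands_above (Crossing _) = 2"

fun strands_below :: "'o piece \<Rightarrow> nat" where
  "strands_below (Cap _) = 2"
| "strands_below Cup = 0"
| "strands_below (Crossing _) = 2"

text \<open>
  The rules \<open>exchange\<close>, \<open>zigzag\<close> and \<open>slide\<close> are the planar isotopies: two events far apart
  change their relative height, a maximum cancels against an adjacent minimum, and a strand
  crossing one leg of an extremum is moved across to the other leg.
\<close>

inductive local_move :: "bool diagram \<Rightarrow> bool diagram \<Rightarrow> bool" where
  exchange:
    "local_move [(i, e), (i + strands_below e + k, f)] [(i + strands_above e + k, f), (i, e)]"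
| zigzag_left: "local_move [(i, Cap b), (i + 1, Cup)] []"
| zigzag_right: "local_move [(i + 1, Cap b), (i, Cup)] []"
| slide_cap:
    "local_move [(i, Cap b), (i + 1, Crossing s)] [(i + 1, Cap b), (i, Crossing (\<not> s))]"
| slide_cup:
    "local_move [(i + 1, Crossing s), (i, Cup)] [(i, Crossing (\<not> s)), (i + 1, Cup)]"
| reidemeister1_cap: "local_move [(i, Cap b), (i, Crossing s)] [(i, Cap (\<not> b))]"
| reidemeister1_cup: "local_move [(i, Crossing s), (i, Cup)] [(i, Cup)]"
| reidemeister2: "local_move [(i, Crossing s), (i, Crossing (\<not> s))] []"
| reidemeister3:
    "local_move [(i, Crossing s), (i + 1, Crossing s), (i, Crossing s)]
                [(i + 1, Crossing s), (i, Crossing s), (i + 1, Crossing s)]"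

inductive diagram_move :: "bool diagram \<Rightarrow> bool diagram \<Rightarrow> bool" where
  "local_move w w' \<Longrightarrow> link_diagram (u @ w @ v) \<Longrightarrow> link_diagram (u @ w' @ v) \<Longrightarrow>
     diagram_move (u @ w @ v) (u @ w' @ v)"

definition isotopic :: "bool diagram \<Rightarrow> bool diagram \<Rightarrow> bool" where
  "isotopic = equivclp diagram_move"


definition trivial_knot :: "bool diagram" where
  "trivial_knot = [(0, Cap True), (0, Cup)]"

text \<open>
  \<open>skein_triple L\<^sub>+ L\<^sub>- L\<^sub>0\<close>. If the two strands at the crossing have the same vertical direction,
  the crossing is positive when the strand from upper right to lower left passes over, and the
  oriented smoothing consists of two vertical strands. If the directions are opposite, the
  crossing is positive when the other strand passes over, and the oriented smoothing is a minimum
  above a maximum.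
\<close>

inductive skein_triple :: "bool diagram \<Rightarrow> bool diagram \<Rightarrow> bool diagram \<Rightarrow> bool" where
  parallel:
    "tangle [] u (xs @ [b, b] @ ys) \<Longrightarrow> tangle (xs @ [b, b] @ ys) v [] \<Longrightarrow>
     skein_triple (u @ [(length xs, Crossing False)] @ v)
                  (u @ [(length xs, Crossing True)] @ v)
                  (u @ v)"
| antiparallel:
    "tangle [] u (xs @ [b, \<not> b] @ ys) \<Longrightarrow> tangle (xs @ [\<not> b, b] @ ys) v [] \<Longrightarrow>
     skein_triple (u @ [(length xs, Crossing True)] @ v)
                  (u @ [(length xs, Crossing False)] @ v)
                  (u @ [(length xs, Cup), (length xs, Cap (\<not> b))] @ v)"

text \<open>
  The axioms defining the Conway polynomial, as a function of oriented links, i.e. of diagrams up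
  to isotopy. Values on lists that are not link diagrams are irrelevant.
\<close>

definition is_conway_polynomial :: "(bool diagram \<Rightarrow> int poly) \<Rightarrow> bool" where
  "is_conway_polynomial nabla \<longleftrightarrow>
     (\<forall>D D'. isotopic D D' \<longrightarrow> nabla D = nabla D') \<and>
     nabla trivial_knot = 1 \<and>
     (\<forall>Lp Lm L0. skein_triple Lp Lm L0 \<longrightarrow> nabla Lp - nabla Lm = [:0, 1:] * nabla L0)"


text \<open>
  The standard diagram of \<open>P(p 1, \<dots>, p n)\<close>: column \<open>i\<close> consists of the strands \<open>2 (i - 1)\<close> and
  \<open>2 (i - 1) + 1\<close> (counted from 0). The extrema at position 0 join the outermost strands; nested
  inside them, those at the positions \<open>1, 3, \<dots>, 2 n - 3\<close> join adjacent columns.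
  Which handedness counts as positive is a convention; the other one gives the mirror images.
\<close>

definition pretzel_column :: "nat \<Rightarrow> int \<Rightarrow> 'o diagram" where
  "pretzel_column i q = replicate (nat \<bar>q\<bar>) (2 * (i - 1), Crossing (q > 0))"

definition pretzel :: "nat \<Rightarrow> (nat \<Rightarrow> int) \<Rightarrow> unit diagram" where
  "pretzel n p =
     [(0, Cap ())] @ map (\<lambda>i. (2 * i - 1, Cap ())) [1..<n] @
     concat (map (\<lambda>i. pretzel_column i (p i)) [1..<n + 1]) @
     rev (map (\<lambda>i. (2 * i - 1, Cup)) [1..<n]) @ [(0, Cup)]"

end

theory Submission
  imports Defs
begin

text \<open>
  The right end of the pretzel diagram, from column \<open>i\<close> on, is a tangle \<open>T i\<close> with four end points,
  and \<open>T i\<close> arises from \<open>T (i + 1)\<close> by putting column \<open>i\<close> to its left. Orientability forces the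
  odd columns to have parallel strands, with alternating directions. By the skein relation a
  parallel column of \<open>q\<close> crossings equals \<open>B (q - 1) + B q * s\<close>, where \<open>s\<close> is a single crossing
  and \<open>B (q + 1) = B (q - 1) - z * B q\<close>; equivalently it equals \<open>B (q + 1) + B q / s\<close>. Hence, from
  right to left, \<open>T i\<close> is a combination of the trivial tangle and, alternately, \<open>1 / s\<close> and the
  horizontal smoothing. The coefficient of the latter is the product of the \<open>B (p j)\<close>, that of the
  trivial tangle is the sum over \<open>j\<close> of \<open>B (p j + 1)\<close> or \<open>B (p j - 1)\<close>, in alternation, times
  the product of the other \<open>B (p k)\<close>. If \<open>n\<close> is even, column 1 is parallel too, and the polynomial
  is the coefficient of the trivial tangle in \<open>T 1\<close>. If \<open>n\<close> is odd, column 1 is antiparallel and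
  equals the trivial tangle plus \<open>p 1 / 2 * z\<close> times the horizontal smoothing. It remains to read
  off the coefficients modulo \<open>z^3\<close>, where the alternating signs cancel.
\<close>

subsection \<open>Levels of diagrams\<close>

text \<open>A partial function in place of the relation \<open>elementary\<close>, so that the
  typing of concrete diagrams is decided by rewriting. \<open>None\<close> marks too few strands or
  a clash of directions.\<close>

fun act :: "nat \<times> bool piece \<Rightarrow> bool list \<Rightarrow> bool list option" where
  "act (i, Cap b) l = (if i \<le> length l then Some (take i l @ [b, \<not> b] @ drop i l) else None)"
| "act (i, Cup) l =
     (if Suc i < length l \<and> l ! i = (\<not> l ! Suc i) then Some (take i l @ drop (i + 2) l) else None)"
| "act (i, Crossing s) l =
     (if Suc i < length l then Some (take i l @ [l ! Suc i, l ! i] @ drop (i + 2) l) else None)"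

fun run :: "bool diagram \<Rightarrow> bool list \<Rightarrow> bool list option" where
  "run [] l = Some l"
| "run (e # D) l = Option.bind (act e l) (run D)"

lemma run_append: "run (D @ E) l = Option.bind (run D l) (run E)"
  by (induction D arbitrary: l) (auto split: bind_splits)

lemma split_two:
  assumes "Suc i < length l"
  shows "take i l @ l ! i # l ! Suc i # drop (Suc (Suc i)) l = l"
  using assms by (simp add: Cons_nth_drop_Suc)

lemma act_iff_elementary:
  "act (i, e) l = Some m \<longleftrightarrow>
     (\<exists>xs ys a b. i = length xs \<and> l = xs @ a @ ys \<and> m = xs @ b @ ys \<and> elementary e a b)"
  (is "?L \<longleftrightarrow> ?R")
proof
  assume L: ?L
  show ?R
  proof (cases e)
    case (Cap b)
    then have "i = length (take i l)" "l = take i l @ [] @ drop i l"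
      "m = take i l @ [b, \<not> b] @ drop i l" "elementary e [] [b, \<not> b]"
      using L by (auto simp: elementary.intros split: if_splits)
    then show ?thesis by blast
  next
    case Cup
    then have "i = length (take i l)" "l = take i l @ [l ! i, \<not> l ! i] @ drop (i + 2) l"
      "m = take i l @ [] @ drop (i + 2) l" "elementary e [l ! i, \<not> l ! i] []"
      using L split_two[of i l] by (auto simp: elementary.intros split: if_splits)
    then show ?thesis by blast
  next
    case (Crossing s)
    then have "i = length (take i l)" "l = take i l @ [l ! i, l ! Suc i] @ drop (i + 2) l"
      "m = take i l @ [l ! Suc i, l ! i] @ drop (i + 2) l"
      "elementary e [l ! i, l ! Suc i] [l ! Suc i, l ! i]"
      using L split_two[of i l] by (auto simp: elementary.intros split: if_splits)
    then show ?thesis by blast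
  qed
next
  assume ?R
  then show ?L by (auto elim!: elementary.cases simp: nth_append)
qed

lemma tangle_iff_run: "tangle l D m \<longleftrightarrow> run D l = Some m"
proof
  show "tangle l D m \<Longrightarrow> run D l = Some m"
  proof (induction rule: tangle.induct)
    case (2 e l l' xs ys D m)
    then have "act (length xs, e) (xs @ l @ ys) = Some (xs @ l' @ ys)"
      by (auto simp: act_iff_elementary)
    with 2 show ?case by simp
  qed simp
next
  show "run D l = Some m \<Longrightarrow> tangle l D m"
  proof (induction D arbitrary: l)
    case (Cons ie D)
    obtain i e where ie: "ie = (i, e)" by (cases ie)
    with Cons.prems obtain l' where l': "act (i, e) l = Some l'" "run D l' = Some m"
      by (auto simp: bind_eq_Some_conv)
    then show ?case
      using Cons.IH[OF l'(2)] ie by (auto simp: act_iff_elementary intro: tangle.intros)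
  qed (auto intro: tangle.intros)
qed

section \<open>Horizontal translation and added strands\<close>

definition shift :: "nat \<Rightarrow> bool diagram \<Rightarrow> bool diagram" where
  "shift k = map (apfst ((+) k))"

lemma shift_simps [simp]:
  "shift k [] = []"
  "shift k ((i, e) # D) = (k + i, e) # shift k D"
  "shift k (D @ E) = shift k D @ shift k E"
  "shift k (replicate n (i, e)) = replicate n (k + i, e)"
  by (simp_all add: shift_def)

lemma shift_shift [simp]: "shift k (shift j D) = shift (k + j) D"
  by (induction D) (auto simp: shift_def)

lemma shift_0 [simp]: "shift 0 D = D"
  by (induction D) (auto simp: shift_def)

lemma act_shift:
  "act (length xs + i, e) (xs @ l) = map_option ((@) xs) (act (i, e) l)"
  by (cases e) (auto simp: nth_append)

lemma run_shift:
  "run (shift (length xs) D) (xs @ l) = map_option ((@) xs) (run D l)"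
proof (induction D arbitrary: l)
  case (Cons ie D)
  then show ?case
    by (cases ie) (auto simp: act_shift option.map_comp bind_map_option Option.bind_map_option
        comp_def split: bind_splits option.splits simp del: act.simps, (cases "act ie l"; simp)?)
qed simp

text \<open>Only an implication, unlike on the left: extra strands on the right can make an event
  applicable that was not.\<close>

lemma act_append_right: "act ie l = Some m \<Longrightarrow> act ie (l @ ys) = Some (m @ ys)"
  by (cases ie) (fastforce simp: act_iff_elementary)

lemma run_append_right: "run D l = Some m \<Longrightarrow> run D (l @ ys) = Some (m @ ys)"
  by (induction D arbitrary: l) (auto simp: bind_eq_Some_conv dest: act_append_right)

lemma run_in_context:
  assumes "run D l = Some m"
  shows "run (shift (length xs) D) (xs @ l @ ys) = Some (xs @ m @ ys)"
  using run_append_right[OF assms, of ys] by (simp add: run_shift)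

lemma local_move_shift:
  assumes "local_move w w'"
  shows "local_move (shift k w) (shift k w')"
  using assms
proof cases
  case (exchange i e j f)
  then show ?thesis using local_move.exchange[of "k + i" e j f] by (simp add: add.assoc)
qed (auto simp flip: add.assoc intro: local_move.intros simp del: One_nat_def)

subsection \<open>Values of tangles in a frame\<close>

type_synonym frame = "bool diagram \<times> nat \<times> bool diagram"

text \<open>The outside of a tangle in a closed diagram. Positions count strands to the left, so of
  the strands beside the hole only the number \<open>k\<close> has to be kept.\<close>

definition frames :: "bool list \<Rightarrow> bool list \<Rightarrow> frame set" where
  "frames l m = {(u, k, v). \<exists>xs ys. k = length xs \<and>
     run u [] = Some (xs @ l @ ys) \<and> run v (xs @ m @ ys) = Some []}"

lemma framesI:
  "k = length xs \<Longrightarrow> run u [] = Some (xs @ l @ ys) \<Longrightarrow> run v (xs @ m @ ys) = Some [] \<Longrightarrow>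
    (u, k, v) \<in> frames l m"
  unfolding frames_def by blast

lemma run_plugged:
  assumes "run u [] = Some (xs @ l @ ys)" "run v (xs @ m @ ys) = Some []" "run D l = Some m"
  shows "link_diagram (u @ shift (length xs) D @ v)"
  using assms run_in_context[OF assms(3), of xs ys]
  by (simp add: link_diagram_def tangle_iff_run run_append)

text \<open>Part of a tangle passes into the outside, leaving a smaller hole. With
  \<open>val_plug\<close>, facts about a small tangle thereby apply inside a larger one.\<close>

fun plug :: "frame \<Rightarrow> bool diagram \<Rightarrow> nat \<Rightarrow> bool diagram \<Rightarrow> frame" where
  "plug (u, k, v) A j B = (u @ shift k A, k + j, shift k B @ v)"

lemma plug_in_frames:
  assumes "c \<in> frames l m" "run A l = Some (xs @ l' @ ys)" "j = length xs"
    "run B (xs @ m' @ ys) = Some m"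
  shows "plug c A j B \<in> frames l' m'"
proof -
  obtain u k v where c: "c = (u, k, v)" by (cases c)
  with assms obtain xs0 ys0 where *: "k = length xs0" "run u [] = Some (xs0 @ l @ ys0)"
      "run v (xs0 @ m @ ys0) = Some []"
    by (auto simp: frames_def)
  have "run (shift k A) (xs0 @ l @ ys0) = Some ((xs0 @ xs) @ l' @ (ys @ ys0))"
    using run_in_context[OF assms(2), of xs0 ys0] * by simp
  moreover have "run (shift k B) ((xs0 @ xs) @ m' @ (ys @ ys0)) = Some (xs0 @ m @ ys0)"
    using run_in_context[OF assms(4), of xs0 ys0] * by simp
  ultimately show ?thesis
    using * assms(3) framesI[of "k + j" "xs0 @ xs" "u @ shift k A" l' "ys @ ys0" "shift k B @ v" m'] c
    by (simp add: run_append)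
qed

lemma local_move_isotopic:
  assumes "local_move w w'" "link_diagram (u @ w @ v)" "link_diagram (u @ w' @ v)"
  shows "isotopic (u @ w @ v) (u @ w' @ v)"
  using assms unfolding isotopic_def by (blast intro: diagram_move.intros r_into_equivclp)

definition z :: "int poly" where "z = [:0, 1:]"

locale conway =
  fixes nabla :: "bool diagram \<Rightarrow> int poly"
  assumes conway: "is_conway_polynomial nabla"
begin

fun val :: "frame \<Rightarrow> bool diagram \<Rightarrow> int poly" where
  "val (u, k, v) D = nabla (u @ shift k D @ v)"

lemma val_plug: "val (plug c A j B) D = val c (A @ shift j D @ B)"
  by (cases c) simp

text \<open>The rules of \<open>local_move\<close> do not check directions, hence the two typing
  assumptions; the disjunction lets a move be read in either direction.\<close>

lemma val_move:
  assumes c: "c \<in> frames l m" and w: "local_move w w' \<or> local_move w' w"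
    and "run (A @ w @ B) l = Some m" "run (A @ w' @ B) l = Some m"
  shows "val c (A @ w @ B) = val c (A @ w' @ B)"
proof -
  obtain u k v where uv: "c = (u, k, v)" by (cases c)
  with c obtain xs ys where *: "k = length xs" "run u [] = Some (xs @ l @ ys)"
      "run v (xs @ m @ ys) = Some []"
    by (auto simp: frames_def)
  have "link_diagram ((u @ shift k A) @ shift k w @ (shift k B @ v))"
    "link_diagram ((u @ shift k A) @ shift k w' @ (shift k B @ v))"
    using run_plugged[OF *(2,3) assms(3)] run_plugged[OF *(2,3) assms(4)] *(1) by simp_all
  then have "isotopic (u @ shift k (A @ w @ B) @ v) (u @ shift k (A @ w' @ B) @ v) \<or>
      isotopic (u @ shift k (A @ w' @ B) @ v) (u @ shift k (A @ w @ B) @ v)"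
    using w local_move_isotopic[OF local_move_shift] by fastforce
  then show ?thesis
    using conway uv unfolding is_conway_polynomial_def by auto
qed

lemma val_crossing_parallel:
  assumes c: "c \<in> frames l m" and A: "run A l = Some (xs @ [b, b] @ ys)"
    and B: "run B (xs @ [b, b] @ ys) = Some m" and i: "i = length xs"
  shows "val c (A @ [(i, Crossing False)] @ B) =
    val c (A @ [(i, Crossing True)] @ B) + z * val c (A @ B)"
proof -
  obtain u k v where uv: "plug c A i B = (u, k, v)" by (cases "plug c A i B")
  with plug_in_frames[OF c A i B] obtain xs ys where *: "k = length xs"
      "run u [] = Some (xs @ [b, b] @ ys)" "run v (xs @ [b, b] @ ys) = Some []"
    by (auto simp: frames_def)
  have "skein_triple (u @ [(k, Crossing False)] @ v) (u @ [(k, Crossing True)] @ v) (u @ v)"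
    unfolding *(1) using *(2,3) by (intro skein_triple.parallel) (auto simp: tangle_iff_run)
  then have "nabla (u @ [(k, Crossing False)] @ v) - nabla (u @ [(k, Crossing True)] @ v)
      = z * nabla (u @ v)"
    using conway unfolding is_conway_polynomial_def z_def by blast
  then show ?thesis
    using val_plug[of c A i B "[(0, Crossing False)]"] val_plug[of c A i B "[(0, Crossing True)]"]
      val_plug[of c A i B "[]"] uv by (simp add: algebra_simps)
qed

lemma val_crossing_antiparallel:
  assumes c: "c \<in> frames l m" and A: "run A l = Some (xs @ [b, \<not> b] @ ys)"
    and B: "run B (xs @ [\<not> b, b] @ ys) = Some m" and i: "i = length xs"
  shows "val c (A @ [(i, Crossing True)] @ B) =
    val c (A @ [(i, Crossing False)] @ B) + z * val c (A @ [(i, Cup), (i, Cap (\<not> b))] @ B)"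
proof -
  obtain u k v where uv: "plug c A i B = (u, k, v)" by (cases "plug c A i B")
  with plug_in_frames[OF c A i B] obtain xs ys where *: "k = length xs"
      "run u [] = Some (xs @ [b, \<not> b] @ ys)" "run v (xs @ [\<not> b, b] @ ys) = Some []"
    by (auto simp: frames_def)
  have "skein_triple (u @ [(k, Crossing True)] @ v) (u @ [(k, Crossing False)] @ v)
      (u @ [(k, Cup), (k, Cap (\<not> b))] @ v)"
    unfolding *(1) using *(2,3) by (intro skein_triple.antiparallel) (auto simp: tangle_iff_run)
  then have "nabla (u @ [(k, Crossing True)] @ v) - nabla (u @ [(k, Crossing False)] @ v)
      = z * nabla (u @ [(k, Cup), (k, Cap (\<not> b))] @ v)"
    using conway unfolding is_conway_polynomial_def z_def by blast
  then show ?thesis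
    using val_plug[of c A i B "[(0, Crossing False)]"] val_plug[of c A i B "[(0, Crossing True)]"]
      val_plug[of c A i B "[(0, Cup), (0, Cap (\<not> b))]"] uv by (simp add: algebra_simps)
qed

section \<open>Kinks and split circles\<close>

lemma frames_mono: "c \<in> frames (l @ t) (m @ t) \<Longrightarrow> c \<in> frames l m"
  using plug_in_frames[of c "l @ t" "m @ t" "[]" "[]" l t 0 "[]" m]
  by (cases c) simp

lemma kink_cap:
  assumes c: "c \<in> frames l m" and "run (A @ [(i, Cap b), (i, Crossing s)] @ B) l = Some m"
    and "run (A @ [(i, Cap (\<not> b))] @ B) l = Some m"
  shows "val c (A @ [(i, Cap b), (i, Crossing s)] @ B) = val c (A @ [(i, Cap (\<not> b))] @ B)"
  using assms by (intro val_move) (auto intro: local_move.intros)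

text \<open>Sliding over the maximum brings the crossing directly above the minimum, where
  Reidemeister 1 removes it; what is left is a zigzag.\<close>

lemma right_kink:
  assumes c: "c \<in> frames [x] [x]"
  shows "val c [(1, Cap x), (0, Crossing s), (1, Cup)] = val c []"
proof -
  have "val c [(1, Cap x), (0, Crossing s), (1, Cup)]
      = val c [(0, Cap x), (1, Crossing (\<not> s)), (1, Cup)]"
    using val_move[OF c, of "[(0 + 1, Cap x), (0, Crossing s)]"
        "[(0, Cap x), (0 + 1, Crossing (\<not> s))]" "[]" "[(1, Cup)]"]
      local_move.slide_cap[of 0 x "\<not> s"] by simp
  also have "\<dots> = val c [(0, Cap x), (1, Cup)]"
    using val_move[OF c, of "[(1, Crossing (\<not> s)), (1, Cup)]" "[(1, Cup)]" "[(0, Cap x)]" "[]"]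
      local_move.reidemeister1_cup[of 1 "\<not> s"] by simp
  also have "\<dots> = val c []"
    using val_move[OF c, of "[(0, Cap x), (1, Cup)]" "[]" "[]" "[]"]
      local_move.zigzag_left[of 0 x] by simp
  finally show ?thesis .
qed

text \<open>Here the slide takes place at the minimum and Reidemeister 1 at the maximum.\<close>

lemma left_kink:
  assumes c: "c \<in> frames [x] [x]"
  shows "val c [(0, Cap (\<not> x)), (1, Crossing s), (0, Cup)] = val c []"
proof -
  have "val c [(0, Cap (\<not> x)), (1, Crossing s), (0, Cup)]
      = val c [(0, Cap (\<not> x)), (0, Crossing (\<not> s)), (1, Cup)]"
    using val_move[OF c, of "[(0 + 1, Crossing s), (0, Cup)]"
        "[(0, Crossing (\<not> s)), (0 + 1, Cup)]" "[(0, Cap (\<not> x))]" "[]"]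
      local_move.slide_cup[of 0 s] by simp
  also have "\<dots> = val c [(0, Cap x), (1, Cup)]"
    using val_move[OF c, of "[(0, Cap (\<not> x)), (0, Crossing (\<not> s))]" "[(0, Cap x)]" "[]" "[(1, Cup)]"]
      local_move.reidemeister1_cap[of 0 "\<not> x" "\<not> s"] by simp
  also have "\<dots> = val c []"
    using val_move[OF c, of "[(0, Cap x), (1, Cup)]" "[]" "[]" "[]"]
      local_move.zigzag_left[of 0 x] by simp
  finally show ?thesis .
qed

text \<open>
  Resolving the crossing of a kink yields a split circle, while both signs of the kink can be
  undone; hence the circle contributes 0.
\<close>

lemma circle_right_same:
  assumes c: "c \<in> frames [x] [x]"
  shows "val c [(1, Cap x), (1, Cup)] = 0"
proof -
  have "val c [(1, Cap x), (0, Crossing False), (1, Cup)] =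
      val c [(1, Cap x), (0, Crossing True), (1, Cup)] + z * val c [(1, Cap x), (1, Cup)]"
    using val_crossing_parallel[OF c, of "[(1, Cap x)]" "[]" x "[\<not> x]" "[(1, Cup)]" 0] by simp
  then show ?thesis
    using right_kink[OF c, of True] right_kink[OF c, of False] by (simp add: z_def)
qed

text \<open>A crossing inserted into the circle comes off at the minimum without effect and at the
  maximum with a reversal, so the orientation of the circle does not matter.\<close>

lemma circle_right:
  assumes c: "c \<in> frames [x] [x]"
  shows "val c [(1, Cap b), (1, Cup)] = 0"
proof (cases "b = x")
  case False
  have "val c [(1, Cap x), (1, Cup)] = val c [(1, Cap x), (1, Crossing True), (1, Cup)]"
    using val_move[OF c, of "[(1, Cup)]" "[(1, Crossing True), (1, Cup)]" "[(1, Cap x)]" "[]"]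
      local_move.reidemeister1_cup[of 1] by simp
  also have "\<dots> = val c [(1, Cap b), (1, Cup)]"
    using val_move[OF c, of "[(1, Cap x), (1, Crossing True)]" "[(1, Cap b)]" "[]" "[(1, Cup)]"]
      local_move.reidemeister1_cap[of 1 x True] False by auto
  finally show ?thesis using circle_right_same[OF c] by simp
qed (use circle_right_same[OF c] in simp)

text \<open>One crossing slides over the maximum and the other under the minimum, where they meet
  and cancel by Reidemeister 2. This is how \<open>s\<close> in a column cancels
  \<open>1 / s\<close> in the tangle to its right.\<close>

lemma interlocked_kinks:
  assumes c: "c \<in> frames [x, \<not> x] [x, \<not> x]"
  shows "val c [(1, Cap x), (0, Crossing s), (2, Crossing (\<not> s)), (1, Cup)]
    = val c [(0, Cup), (0, Cap x)]"
proof -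
  have "val c [(1, Cap x), (0, Crossing s), (2, Crossing (\<not> s)), (1, Cup)]
      = val c [(0, Cap x), (1, Crossing (\<not> s)), (2, Crossing (\<not> s)), (1, Cup)]"
    using val_move[OF c, of "[(0 + 1, Cap x), (0, Crossing s)]"
        "[(0, Cap x), (0 + 1, Crossing (\<not> s))]" "[]" "[(2, Crossing (\<not> s)), (1, Cup)]"]
      local_move.slide_cap[of 0 x "\<not> s"] by (simp add: numeral_2_eq_2)
  also have "\<dots> = val c [(0, Cap x), (1, Crossing (\<not> s)), (1, Crossing s), (2, Cup)]"
    using val_move[OF c, of "[(1 + 1, Crossing (\<not> s)), (1, Cup)]"
        "[(1, Crossing s), (1 + 1, Cup)]" "[(0, Cap x), (1, Crossing (\<not> s))]" "[]"]
      local_move.slide_cup[of 1 "\<not> s"] by (simp add: numeral_2_eq_2)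
  also have "\<dots> = val c [(0, Cap x), (2, Cup)]"
    using val_move[OF c, of "[(1, Crossing (\<not> s)), (1, Crossing s)]" "[]" "[(0, Cap x)]" "[(2, Cup)]"]
      local_move.reidemeister2[of 1 "\<not> s"] by (simp add: numeral_2_eq_2)
  also have "\<dots> = val c [(0, Cup), (0, Cap x)]"
    using val_move[OF c, of "[(0, Cap x), (2, Cup)]" "[(0, Cup), (0, Cap x)]" "[]" "[]"]
      local_move.exchange[of 0 "Cap x" 0 Cup] by (simp add: numeral_2_eq_2)
  finally show ?thesis .
qed

end

subsection \<open>Columns and nests\<close>

text \<open>Fibonacci polynomials at \<open>- z\<close>; up to sign, the Conway polynomials of the
  \<open>(2, n)\<close> torus links with parallel strands.\<close>

fun twist_nat :: "nat \<Rightarrow> int poly" where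
  "twist_nat 0 = 0"
| "twist_nat (Suc 0) = 1"
| "twist_nat (Suc (Suc n)) = twist_nat n - z * twist_nat (Suc n)"

text \<open>
  If \<open>s\<close> is \<open>Crossing True\<close> on two parallel strands, the skein relation reads \<open>1/s = s + z\<close>, and
  \<open>twist q\<close> is the coefficient of \<open>s\<close> in \<open>s^q = twist (q - 1) + twist q * s\<close>.
\<close>

definition twist :: "int \<Rightarrow> int poly" where
  "twist q = (if q \<ge> 0 then twist_nat (nat q) else (-1) ^ (nat (- q) + 1) * twist_nat (nat (- q)))"

lemma twist_simps: "twist 0 = 0" "twist 1 = 1" "twist (-1) = 1"
  by (simp_all add: twist_def)

text \<open>The sign of \<open>twist\<close> at negative arguments is the one that continues the
  recursion across 0, so both handednesses obey the same formulas.\<close>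

lemma twist_rec: "twist (q + 1) = twist (q - 1) - z * twist q"
proof (cases "q \<ge> 1")
  case True
  define n where "n = nat (q - 1)"
  with True have "q = int n + 1" by simp
  then show ?thesis by (simp add: twist_def nat_add_distrib)
next
  case False
  show ?thesis
  proof (cases "q = 0")
    case False
    define n where "n = nat (- q - 1)"
    with False \<open>\<not> q \<ge> 1\<close> have q: "q = - int n - 1" by simp
    have nats: "nat (- (q - 1)) = Suc (Suc n)" "nat (- q) = Suc n" "nat (- (q + 1)) = n"
      and neg: "q < 0" "q - 1 < 0"
      using q by auto
    have "twist (q - 1) = (-1) ^ (Suc (Suc n) + 1) * twist_nat (Suc (Suc n))"
      using nats neg unfolding twist_def by (simp del: twist_nat.simps)
    moreover have "twist q = (-1) ^ (Suc n + 1) * twist_nat (Suc n)"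
      using nats neg unfolding twist_def by (simp del: twist_nat.simps)
    moreover have "twist (q + 1) = (-1) ^ (n + 1) * twist_nat n"
    \<comment> \<open>For \<open>n = 0\<close> the argument \<open>q + 1\<close> is 0 and falls
      under the nonnegative branch of \<open>twist\<close>.\<close>
    proof (cases "n = 0")
      case False
      then have "q + 1 < 0" using q by simp
      then show ?thesis using nats unfolding twist_def by (simp del: twist_nat.simps)
    qed (use q in \<open>simp add: twist_def\<close>)
    ultimately show ?thesis
      by (cases "even n") simp_all
  qed (simp add: twist_simps)
qed

section \<open>Low-order coefficients of the twist polynomials\<close>

lemma coeff_z_mult:
  "coeff (z * P) 0 = 0" "coeff (z * P) 1 = coeff P 0" "coeff (z * P) 2 = coeff P 1"
  by (simp_all add: numeral_2_eq_2 z_def)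

text \<open>The factors 2 and 8 clear denominators. The three claims go together because the factor
  \<open>z\<close> in the recursion links each coefficient to the one below.\<close>

lemma coeff_twist_nat:
  "coeff (twist_nat n) 0 = of_bool (odd n) \<and>
   2 * coeff (twist_nat n) 1 = (if even n then - int n else 0) \<and>
   8 * coeff (twist_nat n) 2 = (if odd n then (int n)\<^sup>2 - 1 else 0)"
proof (induction n rule: twist_nat.induct)
  case (3 n)
  then show ?case
    by (cases "even n")
      (simp_all only: twist_nat.simps coeff_diff coeff_z_mult,
       auto simp: power2_eq_square algebra_simps)
qed simp_all

lemma coeff_twist:
  "coeff (twist q) 0 = of_bool (odd q)"
  "2 * coeff (twist q) 1 = (if even q then - q else 0)"
  "8 * coeff (twist q) 2 = (if odd q then q\<^sup>2 - 1 else 0)"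
proof -
  have *: "coeff ((-1) ^ (m + 1) * P) k = (-1) ^ (m + 1) * coeff P k" for m k and P :: "int poly"
    by (cases "even m") auto
  have "even (nat q) \<longleftrightarrow> even q" if "q \<ge> 0"
    using that by (simp add: even_nat_iff)
  moreover have "even (nat (- q)) \<longleftrightarrow> even q" if "q < 0"
    using that by (simp add: even_nat_iff)
  ultimately have "coeff (twist q) 0 = of_bool (odd q) \<and>
    2 * coeff (twist q) 1 = (if even q then - q else 0) \<and>
    8 * coeff (twist q) 2 = (if odd q then q\<^sup>2 - 1 else 0)"
    using coeff_twist_nat[of "nat q"] coeff_twist_nat[of "nat (- q)"]
    unfolding twist_def * by auto
  then show "coeff (twist q) 0 = of_bool (odd q)"
    "2 * coeff (twist q) 1 = (if even q then - q else 0)"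
    "8 * coeff (twist q) 2 = (if odd q then q\<^sup>2 - 1 else 0)" by auto
qed

definition column :: "int \<Rightarrow> bool diagram" where
  "column q = replicate (nat \<bar>q\<bar>) (0, Crossing (q > 0))"

text \<open>
  The columns from some index on, with their joining extrema except the outer one, form a tangle
  with two strands at the top and at the bottom: the left strand of the first column and the right
  strand of the last one. This tangle takes the place of the last column of a shorter pretzel
  diagram. The labels \<open>b\<close> orient the maxima between adjacent columns.
\<close>

fun nest :: "(bool \<times> int) list \<Rightarrow> int \<Rightarrow> bool diagram" where
  "nest [] q = column q"
| "nest ((b, p) # R) q = (1, Cap b) # column p @ shift 2 (nest R q) @ [(1, Cup)]"

text \<open>Each label repeats the direction of the strand to its left, so every column is parallel;
  the other leg of the maximum starts the next column in the reverse direction.\<close>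

fun alternate :: "bool \<Rightarrow> 'a list \<Rightarrow> (bool \<times> 'a) list" where
  "alternate x [] = []"
| "alternate x (p # ps) = (x, p) # alternate (\<not> x) ps"

text \<open>
  \<open>rest\<close> and \<open>lead\<close> are the coordinates of a nest in the skein module of its boundary, relative
  to the identity and, depending on the parity, a crossing or a minimum above a maximum. The sign of
  that crossing is chosen so that it cancels against the next column.
\<close>

definition lead :: "int list \<Rightarrow> int poly" where
  "lead ps = prod_list (map twist ps)"

fun rest :: "int list \<Rightarrow> int poly" where
  "rest [] = 0"
| "rest (p # ps) =
     rest ps * twist p + lead ps * twist (if even (length ps) then p + 1 else p - 1)"

section \<open>Directions along columns and commuting events\<close>

lemma run_replicate_crossing:
  "run (replicate n (0, Crossing s)) (a # b # t) = Some ((if even n then [a, b] else [b, a]) @ t)"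
  by (induction n arbitrary: a b) auto

lemma run_column:
  "run (column q) (a # b # t) = Some ((if even q then [a, b] else [b, a]) @ t)"
  by (simp add: column_def run_replicate_crossing even_nat_iff)

lemma run_shift_2: "run (shift 2 D) (a # b # l) = map_option (\<lambda>m. a # b # m) (run D l)"
  using run_shift[of "[a, b]" D l] by (simp add: numeral_2_eq_2 append_Cons[abs_def])

lemma run_replace:
  "(\<And>l. run w l = run w' l) \<Longrightarrow> run (A @ w @ B) l = run (A @ w' @ B) l"
  by (cases "run A l") (simp_all add: run_append)

lemma run_cap_kinks:
  "run ((i, Cap b) # replicate n (i, Crossing s)) l = run [(i, Cap (b = even n))] l"
proof (induction n arbitrary: b)
  case (Suc n)
  have "run ((i, Cap b) # replicate (Suc n) (i, Crossing s)) l
      = run ((i, Cap (\<not> b)) # replicate n (i, Crossing s)) l"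
    by (auto simp: nth_append min_def)
  then show ?case using Suc[of "\<not> b"] by (auto split: if_splits)
qed (auto split: bind_splits)

text \<open>The equality covers failing runs too, so that commuting past a whole list needs no
  typing assumption.\<close>

lemma run_commute:
  assumes "i + 2 \<le> j"
  shows "run [(i, Crossing s), (j, e)] l = run [(j, e), (i, Crossing s)] l"
proof (cases "Suc i < length l")
  case True
  obtain k where k: "j = i + 2 + k" using assms le_Suc_ex by blast
  define xs a b ys where "xs = take i l" "a = l ! i" "b = l ! Suc i" "ys = drop (i + 2) l"
  then have l: "l = xs @ a # b # ys" and i: "i = length xs"
    using True split_two[of i l] by auto
  have "act (j, e) (xs @ c # d # ys) = map_option (\<lambda>m. xs @ c # d # m) (act (k, e) ys)" for c d
  proof -
    have "(@) (xs @ [c, d]) = (\<lambda>m. xs @ c # d # m)" by (simp add: fun_eq_iff)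
    then show ?thesis using act_shift[of "xs @ [c, d]" k e ys] i k by simp
  qed
  moreover have "act (i, Crossing s) (xs @ c # d # m) = Some (xs @ d # c # m)" for c d m
    using i by (simp add: nth_append)
  ultimately show ?thesis
    unfolding l by (cases "act (k, e) ys") simp_all
next
  case False
  with assms have "act (j, e) l = None \<and> act (i, Crossing s) l = None"
    by (cases e) auto
  then show ?thesis by simp
qed

lemma run_commute_list:
  assumes "\<forall>(j, e) \<in> set D. i + 2 \<le> j"
  shows "run ((i, Crossing s) # D) l = run (D @ [(i, Crossing s)]) l"
  using assms
proof (induction D arbitrary: l)
  case (Cons je D)
  obtain j e where je: "je = (j, e)" by (cases je)
  have "run ([(i, Crossing s), (j, e)] @ D) l = run ([(j, e), (i, Crossing s)] @ D) l"
    unfolding run_append using run_commute Cons.prems je by simp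
  also have "\<dots> = Option.bind (act (j, e) l) (run ((i, Crossing s) # D))"
    by (cases "act (j, e) l") simp_all
  also have "\<dots> = Option.bind (act (j, e) l) (run (D @ [(i, Crossing s)]))"
    using Cons.IH Cons.prems by (cases "act (j, e) l") (simp_all del: run.simps)
  also have "\<dots> = run ((je # D) @ [(i, Crossing s)]) l"
    using je by simp
  finally show ?case using je by simp
qed (auto split: bind_splits)

section \<open>Skein evaluation of columns and nests\<close>

context conway
begin

text \<open>The crossings come off the maximum one by one by Reidemeister 1, each reversing its
  label.\<close>

lemma kinks_cap:
  assumes c: "c \<in> frames l m" and "run (A @ [(i, Cap (b = even n))] @ B) l = Some m"
  shows "val c (A @ (i, Cap b) # replicate n (i, Crossing s) @ B)
    = val c (A @ [(i, Cap (b = even n))] @ B)"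
  using assms(2)
proof (induction n arbitrary: b)
  case (Suc n)
  let ?B = "replicate n (i, Crossing s) @ B"
  have "run (A @ ((i, Cap (\<not> b)) # replicate n (i, Crossing s)) @ B) l
      = run (A @ [(i, Cap ((\<not> b) = even n))] @ B) l"
    by (intro run_replace run_cap_kinks)
  also have "(\<not> b) = even n \<longleftrightarrow> b = even (Suc n)" by auto
  finally have *: "run (A @ [(i, Cap (\<not> b))] @ ?B) l = Some m"
    using Suc.prems by simp
  moreover have "run (A @ [(i, Cap b), (i, Crossing s)] @ ?B) l = run (A @ [(i, Cap (\<not> b))] @ ?B) l"
    using run_cap_kinks[of i b 1 s] by (intro run_replace) simp
  ultimately have "val c (A @ [(i, Cap b), (i, Crossing s)] @ ?B) = val c (A @ [(i, Cap (\<not> b))] @ ?B)"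
    using kink_cap[OF c, of A i b s ?B] by simp
  moreover have "(\<not> b) = even n \<longleftrightarrow> b = even (Suc n)" by auto
  ultimately show ?case
    using Suc.IH[of "\<not> b"] Suc.prems by simp
qed simp

lemma val_commute:
  assumes c: "c \<in> frames l m" and "\<forall>(j, e) \<in> set D. i + 2 \<le> j"
    and "run (A @ D @ [(i, Crossing s)] @ B) l = Some m"
  shows "val c (A @ [(i, Crossing s)] @ D @ B) = val c (A @ D @ [(i, Crossing s)] @ B)"
  using assms(2,3)
proof (induction D arbitrary: A)
  case (Cons je D)
  obtain j e where je: "je = (j, e)" by (cases je)
  have "i + 2 \<le> j" using Cons.prems(1) je by simp
  then obtain k where k: "j = i + 2 + k" using le_Suc_ex by blast
  have move: "local_move [(i, Crossing s), (j, e)] [(j, e), (i, Crossing s)]"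
    using local_move.exchange[of i "Crossing s" k e] k by simp
  have "run ((A @ [(j, e)]) @ ((i, Crossing s) # D) @ B) l
      = run ((A @ [(j, e)]) @ (D @ [(i, Crossing s)]) @ B) l"
    using Cons.prems(1) by (intro run_replace run_commute_list) auto
  then have r: "run (A @ [(j, e), (i, Crossing s)] @ D @ B) l = Some m"
    using Cons.prems(2) je by simp
  have "run (A @ [(i, Crossing s), (j, e)] @ D @ B) l = run (A @ [(j, e), (i, Crossing s)] @ D @ B) l"
    using k by (intro run_replace run_commute) simp
  with r have "run (A @ [(i, Crossing s), (j, e)] @ D @ B) l = Some m" by simp
  then have "val c (A @ [(i, Crossing s), (j, e)] @ D @ B) = val c (A @ [(j, e), (i, Crossing s)] @ D @ B)"
    using move r by (intro val_move[OF c]) auto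
  then show ?case
    using Cons.IH[of "A @ [je]"] Cons.prems je by simp
qed simp

lemma val_commute_twists:
  assumes c: "c \<in> frames l m" and D: "\<forall>(j, e) \<in> set D. i + 2 \<le> j"
    and "run (A @ D @ replicate n (i, Crossing s) @ B) l = Some m"
  shows "val c (A @ replicate n (i, Crossing s) @ D @ B)
    = val c (A @ D @ replicate n (i, Crossing s) @ B)"
  using assms(3)
proof (induction n arbitrary: A)
  case (Suc n)
  let ?R = "replicate n (i, Crossing s)"
  have "run (A @ ((i, Crossing s) # D) @ ?R @ B) l = run (A @ (D @ [(i, Crossing s)]) @ ?R @ B) l"
    using D by (intro run_replace run_commute_list)
  then have "val c (A @ (i, Crossing s) # ?R @ D @ B) = val c (A @ (i, Crossing s) # D @ ?R @ B)"
    using Suc.IH[of "A @ [(i, Crossing s)]"] Suc.prems by simp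
  also have "\<dots> = val c (A @ D @ (i, Crossing s) # ?R @ B)"
    using val_commute[OF c D, of A s "?R @ B"] Suc.prems by simp
  finally show ?case by simp
qed simp

text \<open>Since \<open>1 / s\<close> cancels \<open>s\<close> by Reidemeister 2, the skein
  relation gives \<open>s^(n+2) = s^n - z * s^(n+1)\<close>, and likewise for negative powers;
  \<open>twist_rec\<close> is the same recursion.\<close>

lemma val_twists_parallel:
  assumes c: "c \<in> frames [x, x] [x, x]"
  shows "val c (replicate n (0, Crossing True))
      = twist (int n - 1) * val c [] + twist (int n) * val c [(0, Crossing True)]"
    and "val c (replicate n (0, Crossing False))
      = twist (- int n - 1) * val c [] + twist (- int n) * val c [(0, Crossing True)]"
proof -
  have skein: "val c ((0, Crossing False) # D) = val c ((0, Crossing True) # D) + z * val c D"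
    if "run D [x, x] = Some [x, x]" for D
    using val_crossing_parallel[OF c, of "[]" "[]" x "[]" D 0] that by simp
  have cancel: "val c ((0, Crossing s) # (0, Crossing (\<not> s)) # D) = val c D"
    if "run D [x, x] = Some [x, x]" for s D
    using val_move[OF c, of "[(0, Crossing s), (0, Crossing (\<not> s))]" "[]" "[]" D]
      local_move.reidemeister2[of 0 s] that by simp
  have r: "run (replicate n (0, Crossing s)) [x, x] = Some [x, x]" for n s
    by (simp add: run_replicate_crossing)
  show "val c (replicate n (0, Crossing True))
      = twist (int n - 1) * val c [] + twist (int n) * val c [(0, Crossing True)]"
  proof (induction n rule: induct_nat_012)
    case (ge2 n)
    let ?X = "val c []" and ?Y = "val c [(0, Crossing True)]"
    have "val c (replicate (Suc (Suc n)) (0, Crossing True))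
        = val c (replicate n (0, Crossing True)) - z * val c (replicate (Suc n) (0, Crossing True))"
      using skein[OF r[of "Suc n" True]] cancel[OF r[of n True], of False] by simp
    also have "\<dots> = (twist (int n - 1) - z * twist (int n)) * ?X
        + (twist (int n) - z * twist (int n + 1)) * ?Y"
      unfolding ge2 by (simp add: algebra_simps)
    also have "\<dots> = twist (int n + 1) * ?X + twist (int n + 2) * ?Y"
      using twist_rec[of "int n"] twist_rec[of "int n + 1"] by (simp add: add.commute)
    finally show ?case by (simp add: add.commute)
  qed (simp_all add: twist_simps)
  show "val c (replicate n (0, Crossing False))
      = twist (- int n - 1) * val c [] + twist (- int n) * val c [(0, Crossing True)]"
  proof (induction n rule: induct_nat_012)
    case 1
    then show ?case
      using skein[of "[]"] twist_rec[of "-1"] by (simp add: twist_simps)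
  next
    case (ge2 n)
    let ?X = "val c []" and ?Y = "val c [(0, Crossing True)]"
    define q where "q = - int n"
    have q: "- int n = q" "- int (Suc n) = q - 1" "- int (Suc (Suc n)) = q - 2"
      "q - 1 - 1 = q - 2" "q - 2 - 1 = q - 3"
      by (simp_all add: q_def)
    have "val c (replicate (Suc (Suc n)) (0, Crossing False))
        = val c (replicate n (0, Crossing False)) + z * val c (replicate (Suc n) (0, Crossing False))"
      using skein[OF r[of "Suc n" False]] cancel[OF r[of n False], of True] by simp
    also have "\<dots> = (twist (q - 1) + z * twist (q - 2)) * ?X + (twist q + z * twist (q - 1)) * ?Y"
      unfolding ge2 q by (simp add: algebra_simps)
    also have "\<dots> = twist (q - 3) * ?X + twist (q - 2) * ?Y"
      using twist_rec[of "q - 1"] twist_rec[of "q - 2"] by simp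
    finally show ?case unfolding q .
  qed (simp_all add: twist_simps)
qed

text \<open>Both bases are needed: an odd number of columns leaves \<open>1 / s\<close> behind, and
  \<open>s\<close> in the next column cancels it.\<close>

lemma val_column_parallel:
  assumes c: "c \<in> frames [x, x] [x, x]"
  shows "val c (column q) = twist (q - 1) * val c [] + twist q * val c [(0, Crossing True)]"
    and "val c (column q) = twist (q + 1) * val c [] + twist q * val c [(0, Crossing False)]"
proof -
  show *: "val c (column q) = twist (q - 1) * val c [] + twist q * val c [(0, Crossing True)]"
    using val_twists_parallel[OF c, of "nat \<bar>q\<bar>"] by (cases "q > 0") (simp_all add: column_def)
  have "val c [(0, Crossing False)] = val c [(0, Crossing True)] + z * val c []"
    using val_crossing_parallel[OF c, of "[]" "[]" x "[]" "[]" 0] by simp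
  then show "val c (column q) = twist (q + 1) * val c [] + twist q * val c [(0, Crossing False)]"
    unfolding * twist_rec by (simp add: algebra_simps)
qed

text \<open>Switching one crossing cancels a pair, while smoothing it leaves the other crossings
  hanging from a maximum, where they untwist. Each pair thus adds the same term, signed by
  handedness.\<close>

lemma val_column_antiparallel:
  assumes c: "c \<in> frames [x, \<not> x] [x, \<not> x]"
  shows "val c (column (2 * m)) = val c [] + of_int m * z * val c [(0, Cup), (0, Cap x)]"
proof -
  let ?e = "[(0, Cup), (0, Cap x)]"
  have r: "run (replicate (2 * n) (0, Crossing s)) [x, \<not> x] = Some [x, \<not> x]" for n s
    by (simp add: run_replicate_crossing)
  have step: "val c (replicate (2 * Suc n) (0, Crossing s)) = val c (replicate (2 * n) (0, Crossing s))
      + (if s then z else - z) * val c ?e" for n s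
  proof -
    let ?R = "replicate (Suc (2 * n)) (0, Crossing s)"
    have "val c ((0, Crossing True) # ?R) = val c ((0, Crossing False) # ?R)
        + z * val c ([(0, Cup)] @ (0, Cap (\<not> x)) # ?R @ [])"
      using val_crossing_antiparallel[OF c, of "[]" "[]" x "[]" ?R 0]
      by (simp add: run_replicate_crossing)
    \<comment> \<open>The number \<open>Suc (2 * n)\<close> of remaining crossings is odd, so
      untwisting turns the label \<open>\<not> x\<close> into \<open>x\<close>.\<close>
    also have "val c ([(0, Cup)] @ (0, Cap (\<not> x)) # ?R @ []) = val c ?e"
      using kinks_cap[OF c, of "[(0, Cup)]" 0 "\<not> x" "Suc (2 * n)" "[]" s] by simp
    finally have skein: "val c ((0, Crossing True) # ?R) = val c ((0, Crossing False) # ?R) + z * val c ?e" .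
    have "val c ([] @ [(0, Crossing (\<not> s)), (0, Crossing (\<not> \<not> s))] @ replicate (2 * n) (0, Crossing s))
        = val c ([] @ [] @ replicate (2 * n) (0, Crossing s))"
      using r[of n s] local_move.reidemeister2[of 0 "\<not> s"] by (intro val_move[OF c]) auto
    then show ?thesis
      using skein by (cases s) (simp_all)
  qed
  have "val c (replicate (2 * n) (0, Crossing s))
      = val c [] + (if s then of_nat n else - of_nat n) * z * val c ?e" for n s
  proof (induction n)
    case (Suc n)
    show ?case
      unfolding step Suc by (cases s) (simp_all add: algebra_simps)
  qed simp
  from this[of "nat \<bar>m\<bar>" "m > 0"] show ?thesis
    by (simp add: column_def abs_mult nat_mult_distrib split: if_splits)
qed

text \<open>This arises when the tangle to the right of a column is a minimum above a maximum: the
  lower arc straightens, and the minimum rises past the column to cancel the upper maximum.\<close>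

lemma straighten_column:
  assumes c: "c \<in> frames [x, y] [x, y]" and xy: "x = y \<or> even p"
  shows "val c ((1, Cap y) # column p @ [(2, Cup), (2, Cap (\<not> y)), (1, Cup)]) = val c (column p)"
proof -
  let ?A = "(1, Cap y) # column p"
  have r: "run (column p) (x # y # t) = Some (x # y # t)" for t
    using xy by (auto simp: run_column)
  have "val c ((?A @ [(2, Cup)]) @ [(2, Cap (\<not> y)), (1, Cup)] @ []) = val c ((?A @ [(2, Cup)]) @ [] @ [])"
    using local_move.zigzag_right[of 1 "\<not> y"]
    by (intro val_move[OF c]) (auto simp: run_append r numeral_2_eq_2)
  also have "\<dots> = val c ([(1, Cap y)] @ [(2, Cup)] @ column p @ [])"
    using val_commute_twists[OF c, of "[(2, Cup)]" 0 "[(1, Cap y)]" "nat \<bar>p\<bar>" "p > 0" "[]"]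
      r[of "[]"] by (simp add: column_def)
  also have "\<dots> = val c ([] @ [(1, Cap y), (2, Cup)] @ column p)" by simp
  also have "\<dots> = val c ([] @ [] @ column p)"
    using local_move.zigzag_left[of 1 y]
    by (intro val_move[OF c]) (auto simp: r numeral_2_eq_2)
  finally show ?thesis by simp
qed

text \<open>The frame is arbitrary so that the first column and its joining extrema can be absorbed
  into it before the induction hypothesis expands the inner nest.\<close>

lemma val_nest:
  assumes "c \<in> frames [x, x = even (length ps)] [x, x = even (length ps)]"
  shows "val c (nest (alternate x ps) q) = rest (ps @ [q]) * val c [] + lead (ps @ [q]) *
    val c (if even (length ps) then [(0, Crossing False)] else [(0, Cup), (0, Cap x)])"
  using assms
proof (induction ps arbitrary: x c)
  case Nil
  then show ?case using val_column_parallel(2)[of c x q] by (simp add: lead_def)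
next
  case (Cons p ps)
  define y where "y = (x = even (length (p # ps)))"
  \<comment> \<open>The right strand belongs to the last column, so \<open>y\<close> also fits the
    inner nest, whose left strand has direction \<open>\<not> x\<close>.\<close>
  have y: "y = ((\<not> x) = even (length ps))" by (auto simp: y_def)
  have c: "c \<in> frames [x, y] [x, y]" using Cons.prems y_def by simp
  let ?A = "(1, Cap x) # column p"
  let ?E = "if even (length ps) then [(0, Crossing False)] else [(0, Cup), (0, Cap (\<not> x))]"
  have "plug c ?A 2 [(1, Cup)] \<in> frames [\<not> x, y] [\<not> x, y]"
    using plug_in_frames[OF c, of ?A "[x, x]" "[\<not> x, y]" "[]" 2 "[(1, Cup)]" "[\<not> x, y]"]
    by (simp add: run_column)
  from Cons.IH[of _ "\<not> x", OF this[unfolded y]]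
  have expand: "val c (nest (alternate x (p # ps)) q) =
      rest (ps @ [q]) * val c (?A @ [(1, Cup)]) + lead (ps @ [q]) * val c (?A @ shift 2 ?E @ [(1, Cup)])"
    by (simp add: val_plug)
  have col: "val c ((1, Cap x) # column p @ B)
      = twist (p - 1) * val c ((1, Cap x) # B) + twist p * val c ([(1, Cap x), (0, Crossing True)] @ B)"
    if "run B [x, x, \<not> x, y] = Some [x, y]" for B
  proof -
    have "plug c [(1, Cap x)] 0 B \<in> frames [x, x] [x, x]"
      using plug_in_frames[OF c, of "[(1, Cap x)]" "[]" "[x, x]" "[\<not> x, y]" 0 B "[x, x]"] that by simp
    from val_column_parallel(1)[OF this, of p] show ?thesis by (simp add: val_plug)
  qed
  have cx: "c \<in> frames [x] [x]" using frames_mono[of c "[x]" "[y]" "[x]"] c by simp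
  \<comment> \<open>The identity term of the column closes to a split circle, the crossing term to a
    kink.\<close>
  have circle: "val c (?A @ [(1, Cup)]) = twist p * val c []"
    using col[of "[(1, Cup)]"] circle_right[OF cx, of x] right_kink[OF cx, of True] by simp
  show ?case
  proof (cases "even (length ps)")
    case True
    then have y: "y = (\<not> x)" by (simp add: y_def)
    \<comment> \<open>The kink lies on the right strand alone, so the frame is narrowed to
      it.\<close>
    have "plug c [] 1 [] \<in> frames [y] [y]"
      using plug_in_frames[OF c, of "[]" "[x]" "[y]" "[]" 1 "[]" "[y]"] by simp
    from left_kink[OF this, of False]
    have "val c [(1, Cap x), (2, Crossing False), (1, Cup)] = val c []"
      by (simp add: val_plug y numeral_2_eq_2)
    then have "val c (?A @ shift 2 ?E @ [(1, Cup)])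
        = twist (p - 1) * val c [] + twist p * val c [(0, Cup), (0, Cap x)]"
      using col[of "[(2, Crossing False), (1, Cup)]"] interlocked_kinks[of c x True] c True
      by (simp add: y)
    then show ?thesis
      unfolding expand circle using True by (simp add: lead_def algebra_simps)
  next
    case False
    then have y: "y = x" by (simp add: y_def)
    have "val c (?A @ shift 2 ?E @ [(1, Cup)]) = val c (column p)"
      using straighten_column[of c x x p] c False y by simp
    also have "\<dots> = twist (p + 1) * val c [] + twist p * val c [(0, Crossing False)]"
      using val_column_parallel(2)[of c x p] c y by simp
    finally show ?thesis
      unfolding expand circle using False by (simp add: lead_def algebra_simps)
  qed
qed

end

subsection \<open>Orientations and pretzel diagrams\<close>

lemma coeff_mult_012:
  fixes P Q :: "int poly"
  shows "coeff (P * Q) 0 = coeff P 0 * coeff Q 0"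
    "coeff (P * Q) 1 = coeff P 0 * coeff Q 1 + coeff P 1 * coeff Q 0"
    "coeff (P * Q) 2 = coeff P 0 * coeff Q 2 + coeff P 1 * coeff Q 1 + coeff P 2 * coeff Q 0"
  by (simp_all add: coeff_mult numeral_2_eq_2)

text \<open>For odd \<open>p\<close>, \<open>twist p\<close> is 1 plus a multiple of
  \<open>z^2\<close> modulo \<open>z^3\<close>, so the second coefficients add.\<close>

lemma coeff_lead:
  assumes "\<forall>p\<in>set ps. odd p"
  shows "coeff (lead ps) 0 = 1 \<and> coeff (lead ps) 1 = 0 \<and>
    8 * coeff (lead ps) 2 = (\<Sum>p\<leftarrow>ps. p\<^sup>2 - 1)"
  using assms
proof (induction ps)
  case (Cons p ps)
  have "lead (p # ps) = twist p * lead ps" by (simp add: lead_def)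
  then show ?case
    using Cons coeff_twist[of p] by (simp add: coeff_mult_012 del: One_nat_def)
qed (simp add: lead_def)

text \<open>Modulo \<open>z^2\<close>, \<open>twist p\<close> is 1 for odd \<open>p\<close>, and
  \<open>twist (p + 1)\<close>, \<open>twist (p - 1)\<close> are purely linear. The alternating
  shifts by 1 cancel in pairs, leaving only the parity of the length.\<close>

lemma coeff_rest:
  assumes "\<forall>p\<in>set ps. odd p"
  shows "coeff (rest ps) 0 = 0 \<and> 2 * coeff (rest ps) 1 = - sum_list ps - of_bool (odd (length ps))"
  using assms
proof (induction ps)
  case (Cons p ps)
  have "coeff (lead ps) 0 = 1" "coeff (lead ps) 1 = 0" using coeff_lead[of ps] Cons.prems by auto
  then show ?case
    using Cons coeff_twist[of p] coeff_twist[of "p + 1"] coeff_twist[of "p - 1"]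
    by (simp add: coeff_mult_012 del: One_nat_def)
qed simp

text \<open>The label of each column only becomes determined by the boundary condition further left.\<close>

lemma run_nest_odd:
  assumes "odd q" "\<forall>p\<in>set (map snd R). odd p" "run (nest R q) [x, y] = Some m"
  shows "if even (length R) then m = [y, x] \<and> (x = y \<longrightarrow> R = alternate x (map snd R))
    else y = (\<not> x) \<and> (\<exists>w. m = [w, \<not> w] \<and> (w = x \<longrightarrow> R = alternate x (map snd R)))"
  using assms(2,3)
proof (induction R arbitrary: x y m)
  case (Cons bp R)
  obtain b p where bp: "bp = (b, p)" by (cases bp)
  from Cons.prems bp have p: "odd p" by simp
  have "run (nest (bp # R) q) [x, y]
      = Option.bind (run (nest R q) [\<not> b, y]) (\<lambda>m'. run [(1, Cup)] (b # x # m'))"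
    using bp p by (cases "run (nest R q) [\<not> b, y]") (simp_all add: run_column run_append run_shift_2)
  with Cons.prems(2) obtain m' where
    m': "run (nest R q) [\<not> b, y] = Some m'" and m: "run [(1, Cup)] (b # x # m') = Some m"
    by (auto simp only: bind_eq_Some_conv)
  note IH = Cons.IH[OF _ m']
  show ?case
  proof (cases "even (length R)")
    case True
    then show ?thesis using IH Cons.prems(1) m bp by (auto split: if_splits)
  next
    case False
    then show ?thesis using IH Cons.prems(1) m bp by (auto split: if_splits)
  qed
qed (use assms(1) in \<open>simp add: run_column\<close>)

section \<open>Oriented pretzel diagrams and their three layers\<close>

fun caps :: "nat \<Rightarrow> (bool \<times> int) list \<Rightarrow> bool diagram" where
  "caps k [] = []"
| "caps k ((b, p) # R) = (k + 1, Cap b) # caps (k + 2) R"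

fun columns :: "nat \<Rightarrow> (bool \<times> int) list \<Rightarrow> int \<Rightarrow> bool diagram" where
  "columns k [] q = shift k (column q)"
| "columns k ((b, p) # R) q = shift k (column p) @ columns (k + 2) R q"

fun cups :: "nat \<Rightarrow> (bool \<times> int) list \<Rightarrow> bool diagram" where
  "cups k [] = []"
| "cups k (bp # R) = cups (k + 2) R @ [(k + 1, Cup)]"

lemma caps_positions: "(j, e) \<in> set (caps k R) \<Longrightarrow> k < j"
  by (induction k R rule: caps.induct) auto

lemma run_commute_twists:
  assumes "\<forall>(j, e) \<in> set D. i + 2 \<le> j"
  shows "run (replicate n (i, Crossing s) @ D) l = run (D @ replicate n (i, Crossing s)) l"
proof (induction n arbitrary: l)
  case (Suc n)
  let ?R = "replicate n (i, Crossing s)"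
  have "run ([(i, Crossing s)] @ (?R @ D) @ []) l = run ([(i, Crossing s)] @ (D @ ?R) @ []) l"
    by (intro run_replace Suc)
  also have "\<dots> = run ([] @ ((i, Crossing s) # D) @ ?R) l" by simp
  also have "\<dots> = run ([] @ (D @ [(i, Crossing s)]) @ ?R) l"
    using assms by (intro run_replace run_commute_list)
  finally show ?case by simp
qed simp

fun forget :: "nat \<times> bool piece \<Rightarrow> nat \<times> unit piece" where
  "forget (i, Cap b) = (i, Cap ())"
| "forget (i, Cup) = (i, Cup)"
| "forget (i, Crossing s) = (i, Crossing s)"

lemma map_piece_eq_forget: "map_prod id (map_piece (\<lambda>_. ())) = forget"
proof
  show "map_prod id (map_piece (\<lambda>_. ())) e = forget e" for e
    by (cases e rule: forget.cases) auto
qed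

lemma forget_eq_Cap: "forget e = (i, Cap ()) \<longleftrightarrow> (\<exists>b. e = (i, Cap b))"
  by (cases e rule: forget.cases) auto

lemma forget_caps:
  "map forget P = map (\<lambda>i. (h i, Cap ())) xs \<Longrightarrow> distinct xs \<Longrightarrow>
     \<exists>f. P = map (\<lambda>i. (h i, Cap (f i))) xs"
proof (induction xs arbitrary: P)
  case (Cons a xs)
  then obtain b P' where P: "P = (h a, Cap b) # P'" "map forget P' = map (\<lambda>i. (h i, Cap ())) xs"
    by (auto simp: forget_eq_Cap Cons_eq_map_conv)
  with Cons obtain f where "P' = map (\<lambda>i. (h i, Cap (f i))) xs" by auto
  then show ?case
    using P(1) Cons.prems(2) by (intro exI[of _ "f(a := b)"]) auto
qed simp

text \<open>Only maxima lose information when the orientation is forgotten.\<close>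

lemma forget_inject:
  "map forget P = map forget Q \<Longrightarrow> \<forall>i b. (i, Cap b) \<notin> set Q \<Longrightarrow> P = Q"
proof (induction Q arbitrary: P)
  case (Cons e Q)
  then obtain e' P' where P: "P = e' # P'" "forget e' = forget e" "map forget P' = map forget Q"
    by auto
  have "e' = e"
    using P(2) Cons.prems(2) by (cases e rule: forget.cases; cases e' rule: forget.cases) auto
  with P Cons show ?case by auto
qed simp

lemma forget_pretzel_column: "map forget (pretzel_column i q) = pretzel_column i q"
  by (simp add: pretzel_column_def)

lemma oriented_pretzel:
  fixes P :: "bool diagram"
  assumes "map (map_prod id (map_piece (\<lambda>_. ()))) P = pretzel n p"
  obtains b f where "P = [(0, Cap b)] @ map (\<lambda>i. (2 * i - 1, Cap (f i))) [1..<n] @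
     concat (map (\<lambda>i. pretzel_column i (p i)) [1..<n + 1]) @
     rev (map (\<lambda>i. (2 * i - 1, Cup)) [1..<n]) @ [(0, Cup)]"
proof -
  let ?Q = "concat (map (\<lambda>i. pretzel_column i (p i)) [1..<n + 1]) @
     rev (map (\<lambda>i. (2 * i - 1, Cup)) [1..<n]) @ [(0, Cup)] :: bool diagram"
  have Q: "map forget ?Q = concat (map (\<lambda>i. pretzel_column i (p i)) [1..<n + 1]) @
     rev (map (\<lambda>i. (2 * i - 1, Cup)) [1..<n]) @ [(0, Cup)]"
    by (simp add: map_concat forget_pretzel_column comp_def rev_map)
  have split: "\<exists>P1 P2 P3. P = P1 @ P2 @ P3 \<and> map forget P1 = A \<and> map forget P2 = B \<and> map forget P3 = C"
    if PABC: "map forget P = A @ B @ C" for A B C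
  proof -
    obtain P1 Q1 where P: "P = P1 @ Q1" "map forget P1 = A" "map forget Q1 = B @ C"
      using iffD1[OF map_eq_append_conv PABC] by (elim exE conjE) (rule that; simp)
    obtain P2 P3 where "Q1 = P2 @ P3" "map forget P2 = B" "map forget P3 = C"
      using iffD1[OF map_eq_append_conv P(3)] by (elim exE conjE) (rule that; simp)
    with P show ?thesis by (intro exI[of _ P1] exI[of _ P2] exI[of _ P3]) simp
  qed
  \<comment> \<open>The outer maximum is written as a map over a singleton to fit
    \<open>forget_caps\<close>.\<close>
  have "map forget P = map (\<lambda>i. (0, Cap ())) [0::nat] @ map (\<lambda>i. (2 * i - 1, Cap ())) [1..<n] @ map forget ?Q"
    using assms unfolding Q pretzel_def map_piece_eq_forget by simp
  from split[OF this] obtain P1 P2 P3 where P: "P = P1 @ P2 @ P3"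
    and P1: "map forget P1 = map (\<lambda>i. (0, Cap ())) [0::nat]"
    and P2: "map forget P2 = map (\<lambda>i. (2 * i - 1, Cap ())) [1..<n]" and P3: "map forget P3 = map forget ?Q"
    by (elim exE conjE)
  from forget_caps[OF P1] obtain f1 where "P1 = [(0, Cap (f1 0))]" by auto
  moreover from forget_caps[OF P2] obtain f2 where "P2 = map (\<lambda>i. (2 * i - 1, Cap (f2 i))) [1..<n]" by auto
  moreover have "P3 = ?Q"
    by (rule forget_inject[OF P3]) (auto simp: pretzel_column_def)
  ultimately show ?thesis using that P by blast
qed

text \<open>Column \<open>i\<close> starts at position \<open>2 * (i - 1)\<close>, so the offset
  \<open>2 * j\<close> goes with the columns from \<open>Suc j\<close> on.\<close>

lemma caps_upt:
  "caps (2 * j) (map (\<lambda>i. (f i, p i)) [Suc j..<n]) = map (\<lambda>i. (2 * i - 1, Cap (f i))) [Suc j..<n]"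
proof (induction "n - j" arbitrary: j)
  case (Suc d)
  from Suc(1)[of "Suc j"] Suc(2) show ?case
    by (cases "Suc j < n") (simp_all add: upt_conv_Cons)
qed simp

lemma cups_upt:
  "cups (2 * j) (map (\<lambda>i. (f i, p i)) [Suc j..<n]) = rev (map (\<lambda>i. (2 * i - 1, Cup)) [Suc j..<n])"
proof (induction "n - j" arbitrary: j)
  case (Suc d)
  from Suc(1)[of "Suc j"] Suc(2) show ?case
    by (cases "Suc j < n") (simp_all add: upt_conv_Cons)
qed simp

lemma columns_upt:
  "j < n \<Longrightarrow> columns (2 * j) (map (\<lambda>i. (f i, p i)) [Suc j..<n]) (p n) =
     concat (map (\<lambda>i. pretzel_column i (p i)) [Suc j..<Suc n])"
proof (induction "n - j" arbitrary: j)
  case (Suc d)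
  show ?case
  proof (cases "Suc j < n")
    case True
    with Suc(1)[of "Suc j"] Suc(2) show ?thesis
      by (simp add: upt_conv_Cons pretzel_column_def column_def)
  next
    case False
    with Suc(3) have "n = Suc j" by simp
    then show ?thesis by (simp add: pretzel_column_def column_def)
  qed
qed simp

section \<open>Closing up the tangles\<close>

context conway
begin

lemma circle_reverse:
  assumes c: "c \<in> frames l m" and r: "\<And>b. run (A @ [(i, Cap b), (i, Cup)] @ B) l = Some m"
  shows "val c (A @ [(i, Cap (\<not> b)), (i, Cup)] @ B) = val c (A @ [(i, Cap b), (i, Cup)] @ B)"
proof -
  have "run (A @ ([(i, Cap b), (i, Crossing True)]) @ (i, Cup) # B) l
      = run (A @ [(i, Cap (\<not> b))] @ (i, Cup) # B) l"
    using run_cap_kinks[of i b 1 True] by (intro run_replace) simp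
  then have k: "run (A @ [(i, Cap b), (i, Crossing True)] @ (i, Cup) # B) l = Some m"
    using r[of "\<not> b"] by simp
  have "val c (A @ [(i, Cap b), (i, Crossing True)] @ (i, Cup) # B) = val c (A @ [(i, Cap (\<not> b))] @ (i, Cup) # B)"
    using kink_cap[OF c k] r[of "\<not> b"] by simp
  moreover have "val c ((A @ [(i, Cap b)]) @ [(i, Crossing True), (i, Cup)] @ B)
      = val c ((A @ [(i, Cap b)]) @ [(i, Cup)] @ B)"
    using k r[of b] by (intro val_move[OF c]) (auto intro: local_move.reidemeister1_cup)
  ultimately show ?thesis by simp
qed

lemma empty_frame: "([], 0, []) \<in> frames [] []"
  by (rule framesI[of _ "[]" _ _ "[]"]) auto

lemma closure_frame: "([(0, Cap b)], 0, [(0, Cup)]) \<in> frames [b, \<not> b] [b, \<not> b]"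
  by (rule framesI[of _ "[]" _ _ "[]"]) auto

lemma val_trivial: "val ([(0, Cap b)], 0, [(0, Cup)]) [] = 1"
proof -
  have "nabla [(0, Cap True), (0, Cup)] = 1"
    using conway unfolding is_conway_polynomial_def trivial_knot_def by simp
  then show ?thesis
    using circle_reverse[OF empty_frame, of "[]" 0 "[]" True] by (cases b) simp_all
qed

text \<open>All crossings are kinks below the outer maximum. This also settles a pretzel with a
  single column.\<close>

lemma val_closed_column: "val ([(0, Cap b)], 0, [(0, Cup)]) (column q) = 1"
proof -
  have "nabla ((0, Cap b) # column q @ [(0, Cup)]) = nabla [(0, Cap (b = even q)), (0, Cup)]"
    using kinks_cap[OF empty_frame, of "[]" 0 b "nat \<bar>q\<bar>" "[(0, Cup)]" "q > 0"]
    by (simp add: column_def even_nat_iff)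
  then show ?thesis using val_trivial[of "b = even q"] by simp
qed

text \<open>Both signs of a kink on the trivial knot have value 1, so \<open>z\<close> times the
  value of the smoothing is 0.\<close>

lemma val_two_circles: "val ([(0, Cap b)], 0, [(0, Cup)]) [(0, Cup), (0, Cap b)] = 0"
proof -
  let ?c = "([(0, Cap b)], 0, [(0, Cup)])"
  have "val ?c [(0, Crossing s)] = 1" for s
    using val_closed_column[of b "if s then 1 else -1"] by (cases s) (simp_all add: column_def)
  moreover have "val ([], 0, []) ([(0, Cap b)] @ [(0, Crossing True)] @ [(0, Cup)]) =
      val ([], 0, []) ([(0, Cap b)] @ [(0, Crossing False)] @ [(0, Cup)]) +
      z * val ([], 0, []) ([(0, Cap b)] @ [(0, Cup), (0, Cap (\<not> b))] @ [(0, Cup)])"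
    by (rule val_crossing_antiparallel[OF empty_frame, of _ "[]" b "[]"]) auto
  ultimately have "z * nabla [(0, Cap b), (0, Cup), (0, Cap (\<not> b)), (0, Cup)] = 0" by simp
  then have "nabla [(0, Cap b), (0, Cup), (0, Cap (\<not> b)), (0, Cup)] = 0" by (simp add: z_def)
  then show ?thesis
    using circle_reverse[OF empty_frame, of "[(0, Cap b), (0, Cup)]" 0 "[]" b] by simp
qed

text \<open>The standard diagram has all maxima on top. Each column lies to the left of the later
  joining maxima and can be lifted past them, which produces the nest; the typing is carried
  along.\<close>

lemma val_flat:
  assumes c: "c \<in> frames l m"
    and "run (A @ caps k R @ columns k R q @ cups k R @ B) l = Some m"
  shows "val c (A @ caps k R @ columns k R q @ cups k R @ B) = val c (A @ shift k (nest R q) @ B)"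
    and "run (A @ shift k (nest R q) @ B) l = Some m"
proof -
  have "val c (A @ caps k R @ columns k R q @ cups k R @ B) = val c (A @ shift k (nest R q) @ B) \<and>
    run (A @ shift k (nest R q) @ B) l = Some m"
    using assms(2)
  proof (induction k R q arbitrary: A B rule: columns.induct)
    case (2 k b p R q)
    let ?T = "shift k (column p)" and ?D = "caps (k + 2) R"
    let ?E = "columns (k + 2) R q @ cups (k + 2) R @ [(k + 1, Cup)] @ B"
    let ?A = "A @ [(k + 1, Cap b)]"
    have T: "?T = replicate (nat \<bar>p\<bar>) (k, Crossing (p > 0))" by (simp add: column_def)
    have D: "\<forall>(j, e) \<in> set ?D. k + 2 \<le> j" by (auto dest: caps_positions)
    have r: "run (?A @ ?D @ ?T @ ?E) l = Some m" using 2(2) by simp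
    have "run (?A @ (?T @ ?D) @ ?E) l = run (?A @ (?D @ ?T) @ ?E) l"
      unfolding T using D by (intro run_replace run_commute_twists)
    with r have r': "run ((?A @ ?T) @ ?D @ columns (k + 2) R q @ cups (k + 2) R @ ([(k + 1, Cup)] @ B)) l = Some m"
      by simp
    have "val c (?A @ ?T @ ?D @ ?E) = val c (?A @ ?D @ ?T @ ?E)"
      using val_commute_twists[OF c D, of ?A "nat \<bar>p\<bar>" "p > 0" ?E] r unfolding T by simp
    with 2(1)[OF r'] show ?case by simp
  qed simp
  then show "val c (A @ caps k R @ columns k R q @ cups k R @ B) = val c (A @ shift k (nest R q) @ B)"
    and "run (A @ shift k (nest R q) @ B) l = Some m" by auto
qed

text \<open>The other columns contribute either the identity, which leaves the closure of the
  antiparallel first column with value \<open>of_int k * z\<close>, or the horizontal smoothing,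
  which leaves a trivial knot.\<close>

lemma nabla_odd_pretzel:
  assumes "odd (length ps)"
  shows "nabla ((0, Cap b) # nest ((\<not> b, 2 * k) # alternate b ps) q @ [(0, Cup)])
    = of_int k * z * rest (ps @ [q]) + lead (ps @ [q])"
proof -
  define c where "c = ([(0::nat, Cap b)], 0::nat, [(0::nat, Cup :: bool piece)])"
  have c: "c \<in> frames [b, \<not> b] [b, \<not> b]" unfolding c_def by (rule closure_frame)
  let ?A = "(1, Cap (\<not> b)) # column (2 * k)"
  have "plug c ?A 2 [(1, Cup)] \<in> frames [b, \<not> b] [b, \<not> b]"
    using plug_in_frames[OF c, of ?A "[b, \<not> b]" "[b, \<not> b]" "[]" 2 "[(1, Cup)]" "[b, \<not> b]"]
    by (simp add: run_column)
  then have "val (plug c ?A 2 [(1, Cup)]) (nest (alternate b ps) q) =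
      rest (ps @ [q]) * val (plug c ?A 2 [(1, Cup)]) []
      + lead (ps @ [q]) * val (plug c ?A 2 [(1, Cup)]) [(0, Cup), (0, Cap b)]"
    using assms val_nest[of "plug c ?A 2 [(1, Cup)]" b ps q] by simp
  then have "val c (nest ((\<not> b, 2 * k) # alternate b ps) q) = rest (ps @ [q]) * val c (?A @ [(1, Cup)])
      + lead (ps @ [q]) * val c (?A @ [(2, Cup), (2, Cap b), (1, Cup)])"
    by (simp add: val_plug)
  moreover have "val c (?A @ [(2, Cup), (2, Cap b), (1, Cup)]) = 1"
    using straighten_column[OF c, of "2 * k"] val_closed_column[of b] by (simp add: c_def)
  moreover have "val c (?A @ [(1, Cup)]) = of_int k * z"
  proof -
    have "plug c [(1, Cap (\<not> b))] 0 [(1, Cup)] \<in> frames [b, \<not> b] [b, \<not> b]"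
      using plug_in_frames[OF c, of "[(1, Cap (\<not> b))]" "[]" "[b, \<not> b]" "[b, \<not> b]" 0 "[(1, Cup)]"
          "[b, \<not> b]"] by simp
    from val_column_antiparallel[OF this, of k]
    have "val c (?A @ [(1, Cup)]) = val c [(1, Cap (\<not> b)), (1, Cup)]
        + of_int k * z * val c [(1, Cap (\<not> b)), (0, Cup), (0, Cap b), (1, Cup)]"
      by (simp add: val_plug)
    moreover have "val c [(1, Cap (\<not> b)), (1, Cup)] = 0"
      using circle_right[of c b] frames_mono[of c "[b]" "[\<not> b]" "[b]"] c by simp
    moreover have "val c ([] @ [(1, Cap (\<not> b)), (0, Cup)] @ [(0, Cap b), (1, Cup)])
        = val c ([] @ [] @ [(0, Cap b), (1, Cup)])"
      using local_move.zigzag_right[of 0 "\<not> b"] by (intro val_move[OF c]) auto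
    moreover have "val c ([] @ [(0, Cap b), (1, Cup)] @ []) = val c ([] @ [] @ [])"
      using local_move.zigzag_left[of 0 b] by (intro val_move[OF c]) auto
    moreover have "val c [] = 1" unfolding c_def by (rule val_trivial)
    ultimately show ?thesis by simp
  qed
  ultimately have "val c (nest ((\<not> b, 2 * k) # alternate b ps) q) = of_int k * z * rest (ps @ [q]) + lead (ps @ [q])"
    by (simp del: nest.simps add: mult.commute)
  then show ?thesis by (simp add: c_def del: nest.simps)
qed

text \<open>The identity closes to the trivial knot, the horizontal smoothing to two split circles
  with value 0.\<close>

lemma nabla_even_pretzel:
  assumes "odd (length ps)"
  shows "nabla ((0, Cap b) # nest (alternate b ps) q @ [(0, Cup)]) = rest (ps @ [q])"
proof -
  have "val ([(0, Cap b)], 0, [(0, Cup)]) (nest (alternate b ps) q) = rest (ps @ [q])"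
    using val_nest[of "([(0, Cap b)], 0, [(0, Cup)])" b ps q] closure_frame[of b] val_trivial[of b]
      val_two_circles[of b] assms by (simp del: val.simps)
  then show ?thesis by simp
qed

lemma nabla_pretzel:
  assumes "n \<ge> 1" "p 1 = 2 * k" and odd: "\<forall>i\<in>{2..n}. odd (p i)"
    and P: "is_orientation_of P (pretzel n p)"
  shows "nabla P = (if even n then rest (map p [1..<Suc n])
    else of_int k * z * rest (map p [2..<Suc n]) + lead (map p [2..<Suc n]))"
proof -
  from P have shape: "map (map_prod id (map_piece (\<lambda>_. ()))) P = pretzel n p"
    by (simp add: is_orientation_of_def)
  obtain b f where P_eq: "P = [(0, Cap b)] @ map (\<lambda>i. (2 * i - 1, Cap (f i))) [1..<n] @
     concat (map (\<lambda>i. pretzel_column i (p i)) [1..<n + 1]) @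
     rev (map (\<lambda>i. (2 * i - 1, Cup)) [1..<n]) @ [(0, Cup)]"
    by (rule oriented_pretzel[OF shape])
  define R where "R = map (\<lambda>i. (f i, p i)) [1..<n]"
  have P_eq: "P = [(0, Cap b)] @ caps 0 R @ columns 0 R (p n) @ cups 0 R @ [(0, Cup)]"
    using caps_upt[of 0 f p n] cups_upt[of 0 f p n] columns_upt[of 0 n f p] assms(1)
    unfolding P_eq R_def by simp
  have "run P [] = Some []"
    using P by (simp add: is_orientation_of_def link_diagram_def tangle_iff_run)
  note flat = val_flat[OF empty_frame this[unfolded P_eq]]
  have nabla: "nabla P = nabla ((0, Cap b) # nest R (p n) @ [(0, Cup)])"
    using flat(1) unfolding P_eq by simp
  have typed: "run ((0, Cap b) # nest R (p n) @ [(0, Cup)]) [] = Some []"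
    using flat(2) by simp
  show ?thesis
  proof (cases "n = 1")
    case True
    \<comment> \<open>Here the list of odd columns is empty, with \<open>rest [] = 0\<close> and
      \<open>lead [] = 1\<close>.\<close>
    then show ?thesis
      using val_closed_column[of b "p 1"] nabla by (simp add: R_def lead_def)
  next
    case False
    with assms(1) have n: "n \<ge> 2" by simp
    define R' where "R' = map (\<lambda>i. (f i, p i)) [2..<n]"
    have R: "R = (f 1, 2 * k) # R'"
      using n assms(2) by (simp add: R_def R'_def upt_conv_Cons numeral_2_eq_2)
    have snd: "map snd R' = map p [2..<n]" by (simp add: R'_def)
    have ps: "map snd R' @ [p n] = map p [2..<Suc n]" using n by (simp add: snd)
    have len: "even (length R') \<longleftrightarrow> even n" using n by (simp add: R'_def)
    \<comment> \<open>The even first column returns its directions \<open>b\<close>,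
      \<open>f 1\<close> unchanged, so the two last minima constrain \<open>m\<close>
      directly.\<close>
    have "Option.bind (run (nest R' (p n)) [\<not> f 1, \<not> b]) (\<lambda>m. run [(1, Cup), (0, Cup)] (b # f 1 # m)) = Some []"
      using typed R
      by (cases "run (nest R' (p n)) [\<not> f 1, \<not> b]") (simp_all add: run_column run_append run_shift_2)
    then obtain m where m: "run (nest R' (p n)) [\<not> f 1, \<not> b] = Some m"
      "run [(1, Cup), (0, Cup)] (b # f 1 # m) = Some []"
      by (auto simp only: bind_eq_Some_conv)
    have oddR: "\<forall>p\<in>set (map snd R'). odd p" and oddn: "odd (p n)"
      using odd n by (auto simp: snd)
    note typed = run_nest_odd[OF oddn oddR m(1)]
    show ?thesis
    proof (cases "even n")
      case True
      \<comment> \<open>The inner nest swaps its two directions, so the joining minimum forces the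
        first column to be parallel.\<close>
      then have "f 1 = b" "R' = alternate (\<not> b) (map snd R')"
        using typed m(2) len by (auto split: if_splits)
      then have "R = alternate b (2 * k # map p [2..<n])"
        using R snd by simp
      moreover have "odd (length (2 * k # map p [2..<n]))" using True n by simp
      moreover have "(2 * k # map p [2..<n]) @ [p n] = map p [1..<Suc n]"
        using n assms(2) by (simp add: upt_conv_Cons numeral_2_eq_2)
      ultimately show ?thesis
        using nabla_even_pretzel[of "2 * k # map p [2..<n]" b "p n"] nabla True by simp
    next
      case False
      \<comment> \<open>An even number of odd columns needs opposite outer directions, which makes
        the first column antiparallel.\<close>
      then have "f 1 = (\<not> b)" "R' = alternate b (map snd R')"
        using typed m(2) len by (auto split: if_splits)
      then have "R = (\<not> b, 2 * k) # alternate b (map p [2..<n])"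
        using R snd by simp
      moreover have "odd (length (map p [2..<n]))" using False n by simp
      ultimately show ?thesis
        using nabla_odd_pretzel[of "map p [2..<n]" b k "p n"] nabla False ps snd by simp
    qed
  qed
qed

lemma coeff_nabla_pretzel:
  assumes "n \<ge> 1" "even (p 1)" and odd: "\<forall>i\<in>{2..n}. odd (p i)"
    and "is_orientation_of P (pretzel n p)"
  shows "8 * coeff (nabla P) 2 =
    (if even n then (\<Sum>i=1..n. (p i)\<^sup>2) + 2 * p 1 * (\<Sum>i=2..n. p i)
     else (\<Sum>i=2..n. (p i)\<^sup>2) - 2 * p 1 * (\<Sum>i=2..n. p i)) - (int n - 1)"
proof -
  from assms(2) obtain k where k: "p 1 = 2 * k" by blast
  define ps where "ps = map p [2..<Suc n]"
  have odd: "\<forall>q\<in>set ps. odd q" using odd by (auto simp: ps_def)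
  have interval: "set [2..<Suc n] = {2..n}" by auto
  have sum: "sum_list ps = (\<Sum>i=2..n. p i)"
    unfolding ps_def interv_sum_list_conv_sum_set_nat interval ..
  have "(\<Sum>q\<leftarrow>ps. q\<^sup>2 - 1) = (\<Sum>i=2..n. (p i)\<^sup>2 - 1)"
    unfolding ps_def map_map comp_def interv_sum_list_conv_sum_set_nat interval ..
  then have squares: "(\<Sum>q\<leftarrow>ps. q\<^sup>2 - 1) = (\<Sum>i=2..n. (p i)\<^sup>2) - (int n - 1)"
    using assms(1) by (simp add: sum_subtractf of_nat_diff)
  have length: "odd (length ps) \<longleftrightarrow> even n"
    using assms(1) by (cases n) (simp_all add: ps_def del: upt.simps)
  note lead = coeff_lead[OF odd] and rest = coeff_rest[OF odd]
  note nabla = nabla_pretzel[of n p k P, OF assms(1) k assms(3,4)]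
  show ?thesis
  proof (cases "even n")
    case True
    have "[1..<Suc n] = 1 # [2..<Suc n]"
      using assms(1) by (simp add: upt_conv_Cons numeral_2_eq_2)
    then have eq: "nabla P = rest ps * twist (p 1) + lead ps * twist (p 1 - 1)"
      using nabla True length by (simp add: ps_def)
    \<comment> \<open>As \<open>p 1\<close> is even, \<open>twist (p 1)\<close> has no constant
      term, so only the linear coefficient of \<open>rest ps\<close> enters.\<close>
    have "8 * coeff (nabla P) 2 =
        2 * (2 * coeff (rest ps) 1) * (2 * coeff (twist (p 1)) 1) + 8 * coeff (twist (p 1 - 1)) 2
        + (8 * coeff (lead ps) 2) * coeff (twist (p 1 - 1)) 0"
      unfolding eq coeff_add coeff_mult_012 using conjunct1[OF lead]
        conjunct1[OF conjunct2[OF lead]] conjunct1[OF rest] coeff_twist(1)[of "p 1"] assms(2)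
      by simp
    also have "\<dots> = 2 * (sum_list ps + 1) * p 1 + (p 1 - 1)\<^sup>2 - 1 + (\<Sum>q\<leftarrow>ps. q\<^sup>2 - 1)"
    proof -
      have "2 * coeff (rest ps) 1 = - (sum_list ps + 1)" "2 * coeff (twist (p 1)) 1 = - p 1"
        "8 * coeff (twist (p 1 - 1)) 2 = (p 1 - 1)\<^sup>2 - 1" "coeff (twist (p 1 - 1)) 0 = 1"
        "8 * coeff (lead ps) 2 = (\<Sum>q\<leftarrow>ps. q\<^sup>2 - 1)"
        using lead rest coeff_twist[of "p 1"] coeff_twist[of "p 1 - 1"] assms(2) length True
        by auto
      then show ?thesis by (simp only:)
    qed
    \<comment> \<open>The extra \<open>2 * p 1\<close> coming from the parity term cancels the cross
      term of the square of \<open>p 1 - 1\<close>.\<close>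
    also have "\<dots> = (p 1)\<^sup>2 + 2 * p 1 * sum_list ps + (\<Sum>q\<leftarrow>ps. q\<^sup>2 - 1)"
      by (simp add: power2_eq_square algebra_simps)
    also have "\<dots> = (\<Sum>i=1..n. (p i)\<^sup>2) + 2 * p 1 * (\<Sum>i=2..n. p i) - (int n - 1)"
      using sum.atLeast_Suc_atMost[of 1 n "\<lambda>i. (p i)\<^sup>2"] assms(1)
      unfolding squares sum by (simp add: numeral_2_eq_2)
    finally show ?thesis using True by simp
  next
    case False
    then have eq: "nabla P = of_int k * (z * rest ps) + lead ps"
      using nabla by (simp add: ps_def mult.assoc)
    have "8 * coeff (nabla P) 2 = 2 * (2 * k) * (2 * coeff (rest ps) 1) + 8 * coeff (lead ps) 2"
      unfolding eq coeff_add by (simp add: of_int_poly coeff_z_mult)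
    also have "\<dots> = - 2 * p 1 * sum_list ps + (\<Sum>q\<leftarrow>ps. q\<^sup>2 - 1)"
      using lead rest length False k by simp
    finally show ?thesis using False squares sum by simp
  qed
qed

end

theorem lemma1p4:
  fixes n :: nat and p :: "nat \<Rightarrow> int"
    and nabla :: "bool diagram \<Rightarrow> int poly" and P :: "bool diagram"
  assumes "n \<ge> 1"
    and "even (p 1)"
    and "\<forall>i\<in>{2..n}. odd (p i)"
    and "is_conway_polynomial nabla"
    and "is_orientation_of P (pretzel n p)"
  shows
    "(even n \<longrightarrow>
        rat_of_int (coeff (nabla P) 2) =
          1/8 * (\<Sum>i=1..n. (rat_of_int (p i))\<^sup>2)
          + 1/4 * rat_of_int (p 1) * (\<Sum>i=2..n. rat_of_int (p i))
          - 1/8 * (rat_of_nat n - 1)) \<and>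
     (odd n \<longrightarrow>
        rat_of_int (coeff (nabla P) 2) =
          1/8 * (\<Sum>i=2..n. (rat_of_int (p i))\<^sup>2)
          - 1/4 * rat_of_int (p 1) * (\<Sum>i=2..n. rat_of_int (p i))
          - 1/8 * (rat_of_nat n - 1))"
proof -
  interpret conway nabla by unfold_locales (rule assms(4))
  from coeff_nabla_pretzel[OF assms(1,2,3,5)]
  have "rat_of_int (8 * coeff (nabla P) 2) = rat_of_int
    ((if even n then (\<Sum>i=1..n. (p i)\<^sup>2) + 2 * p 1 * (\<Sum>i=2..n. p i)
     else (\<Sum>i=2..n. (p i)\<^sup>2) - 2 * p 1 * (\<Sum>i=2..n. p i)) - (int n - 1))"
    by (rule arg_cong)
  then show ?thesis by (cases "even n") (simp_all add: field_simps)
qed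

end
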